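(* Let $\Gamma=(V,E)$ be a reflexive locally finite vertex-transitive graph such that both $\Gamma$ and $\Gamma^-$ are degenerate. Then one of the following holds: (i) one of the graphs $\Gamma$ and $\Gamma^-$ is not a Cauchy graph, and either a $1$-atom of $\Gamma$ or a $1$-atom of $\Gamma^-$ is a block; (ii) one of the graphs $\Gamma$ and $\Gamma^-$ is not $2$-faithful, and a $2$-super-fragment of the reverse of that graph is a block; (iii) $\Gamma$ and $\Gamma^-$ are $2$-faithful Cauchy graphs and no vertex belongs to three distinct $2$-atoms of $\Gamma$ and to three distinct $2$-atoms of $\Gamma^-$; (iv) the $2$-atoms of $\Gamma$ or the $2$-atoms of $\Gamma^-$ have cardinality $2$.
   Context: A graph is a pair $\Gamma=(V,E)$ with $E\subseteq V\times V$; reflexive means $(x,x)\in E$ for all $x$; $\Gamma(x)=\{y:(x,y)\in E\}$, $\Gamma(X)=\bigcup_{x\in X}\Gamma(x)$; the reverse graph is $\Gamma^-=(V,E^-)$, $E^-=\{(x,y):(y,x)\in E\}$; locally finite means $\Gamma(x)$, $\Gamma^-(x)$ finite for all $x$. An automorphism is a bijection $f:V\to V$ with $\Gamma(f(x))=f(\Gamma(x))$ for all $x$; $\Gamma$ is vertex-transitive if for all $x,y$ some automorphism maps $x$ to $y$. A block is a set $B\subseteq V$ such that for every automorphism $f$, either $f(B)=B$ or $f(B)\cap B=\emptyset$. $\partial(X)=\Gamma(X)\setminus X$, $\nabla(X)=V\setminus\Gamma(X)$. $\Gamma$ is $k$-separable if there is a finite $X$ with $|X|\ge k$, $|\nabla(X)|\ge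 k$; then $\kappa_k(\Gamma)=\min\{|\partial(X)|: X\text{ finite},|X|\ge k,|\nabla(X)|\ge k\}$. A $k$-fragment is a finite $X$ with $|X|\ge k$, $|\nabla(X)|\ge k$, $|\partial(X)|=\kappa_k(\Gamma)$; a $k$-atom is a $k$-fragment of minimum cardinality; when $V$ is finite a $k$-super-fragment is a $k$-fragment of maximum cardinality. A graph is $k$-faithful if $|A|\le|\nabla(A)|$ for a $k$-atom $A$; a Cauchy graph if it is not $1$-separable or it has a $1$-atom $A$ with $|A|=1$ or $|\nabla(A)|=1$; degenerate if it is $2$-separable and $\kappa_2=\kappa_1$. All notions for $\Gamma^-$ are defined by replacing $\Gamma$ with $\Gamma^-$. *)

theory Defs
  imports Main
begin

text \<open>A graph is a pair (V,E) with E a subset of V x V; vertices of type 'a.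
  The reverse graph is (V, converse E).\<close>

definition graph :: "'a set \<Rightarrow> ('a \<times> 'a) set \<Rightarrow> bool" where
  "graph V E \<longleftrightarrow> E \<subseteq> V \<times> V"

definition nbr :: "('a \<times> 'a) set \<Rightarrow> 'a \<Rightarrow> 'a set" where
  "nbr E x = {y. (x, y) \<in> E}"

definition nbrs :: "('a \<times> 'a) set \<Rightarrow> 'a set \<Rightarrow> 'a set" where
  "nbrs E X = (\<Union>x\<in>X. nbr E x)"

definition reflexive_graph :: "'a set \<Rightarrow> ('a \<times> 'a) set \<Rightarrow> bool" where
  "reflexive_graph V E \<longleftrightarrow> (\<forall>x\<in>V. (x, x) \<in> E)"

definition locally_finite :: "'a set \<Rightarrow> ('a \<times> 'a) set \<Rightarrow> bool" where
  "locally_finite V E \<longleftrightarrow> (\<forall>x\<in>V. finite (nbr E x) \<and> finite (nbr (converse E) x))"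

definition automorphism :: "'a set \<Rightarrow> ('a \<times> 'a) set \<Rightarrow> ('a \<Rightarrow> 'a) \<Rightarrow> bool" where
  "automorphism V E f \<longleftrightarrow> bij_betw f V V \<and> (\<forall>x\<in>V. nbr E (f x) = f ` nbr E x)"

definition vertex_transitive :: "'a set \<Rightarrow> ('a \<times> 'a) set \<Rightarrow> bool" where
  "vertex_transitive V E \<longleftrightarrow>
     (\<forall>x\<in>V. \<forall>y\<in>V. \<exists>f. automorphism V E f \<and> f x = y)"

definition is_block :: "'a set \<Rightarrow> ('a \<times> 'a) set \<Rightarrow> 'a set \<Rightarrow> bool" where
  "is_block V E B \<longleftrightarrow> B \<subseteq> V \<and>
     (\<forall>f. automorphism V E f \<longrightarrow> f ` B = B \<or> f ` B \<inter> B = {})"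

definition bdry :: "('a \<times> 'a) set \<Rightarrow> 'a set \<Rightarrow> 'a set" where
  "bdry E X = nbrs E X - X"

definition nabla :: "'a set \<Rightarrow> ('a \<times> 'a) set \<Rightarrow> 'a set \<Rightarrow> 'a set" where
  "nabla V E X = V - nbrs E X"

definition card_ge :: "'a set \<Rightarrow> nat \<Rightarrow> bool" where
  "card_ge S k \<longleftrightarrow> infinite S \<or> k \<le> card S"

definition sep_cand :: "'a set \<Rightarrow> ('a \<times> 'a) set \<Rightarrow> nat \<Rightarrow> 'a set \<Rightarrow> bool" where
  "sep_cand V E k X \<longleftrightarrow> X \<subseteq> V \<and> finite X \<and> k \<le> card X \<and> card_ge (nabla V E X) k"

definition separable :: "'a set \<Rightarrow> ('a \<times> 'a) set \<Rightarrow> nat \<Rightarrow> bool" where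
  "separable V E k \<longleftrightarrow> (\<exists>X. sep_cand V E k X)"

definition kappa :: "'a set \<Rightarrow> ('a \<times> 'a) set \<Rightarrow> nat \<Rightarrow> nat" where
  "kappa V E k = (LEAST n. \<exists>X. sep_cand V E k X \<and> card (bdry E X) = n)"

definition fragment :: "'a set \<Rightarrow> ('a \<times> 'a) set \<Rightarrow> nat \<Rightarrow> 'a set \<Rightarrow> bool" where
  "fragment V E k X \<longleftrightarrow> sep_cand V E k X \<and> card (bdry E X) = kappa V E k"

definition atom :: "'a set \<Rightarrow> ('a \<times> 'a) set \<Rightarrow> nat \<Rightarrow> 'a set \<Rightarrow> bool" where
  "atom V E k A \<longleftrightarrow> fragment V E k A \<and> (\<forall>Y. fragment V E k Y \<longrightarrow> card A \<le> card Y)"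

definition super_fragment :: "'a set \<Rightarrow> ('a \<times> 'a) set \<Rightarrow> nat \<Rightarrow> 'a set \<Rightarrow> bool" where
  "super_fragment V E k X \<longleftrightarrow> finite V \<and> fragment V E k X \<and>
     (\<forall>Y. fragment V E k Y \<longrightarrow> card Y \<le> card X)"

definition faithful :: "'a set \<Rightarrow> ('a \<times> 'a) set \<Rightarrow> nat \<Rightarrow> bool" where
  "faithful V E k \<longleftrightarrow> (\<exists>A. atom V E k A \<and> card_ge (nabla V E A) (card A))"

definition cauchy :: "'a set \<Rightarrow> ('a \<times> 'a) set \<Rightarrow> bool" where
  "cauchy V E \<longleftrightarrow> \<not> separable V E 1 \<or>
     (\<exists>A. atom V E 1 A \<and> (card A = 1 \<or> (finite (nabla V E A) \<and> card (nabla V E A) = 1)))"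

definition degenerate :: "'a set \<Rightarrow> ('a \<times> 'a) set \<Rightarrow> bool" where
  "degenerate V E \<longleftrightarrow> separable V E 2 \<and> kappa V E 2 = kappa V E 1"

end

theory Submission
  imports Defs
begin

text \<open>Write \<open>\<Gamma>\<close> for the graph and \<open>\<Gamma>\<^sup>-\<close> for its reverse. Everything rests on the
  submodularity of \<open>X \<mapsto> |\<Gamma>(X)|\<close>. If one of the graphs is not Cauchy, then \<open>\<Gamma>\<close> or \<open>\<Gamma>\<^sup>-\<close> is
  1-faithful, so its 1-atoms are pairwise disjoint. If \<open>\<Gamma>\<close> is not 2-faithful, the
  2-super-fragments of \<open>\<Gamma>\<^sup>-\<close> are the sets \<open>\<nabla>(A)\<close> of 2-atoms \<open>A\<close>, and these are pairwise disjoint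
  by a counting argument.

  In the remaining case \<open>|\<Gamma>(x)| = \<kappa>\<^sub>2 + 1\<close>, and distinct 2-atoms \<open>A, A'\<close> through \<open>x\<close> satisfy
  \<open>\<Gamma>(A) \<inter> \<Gamma>(A') = \<Gamma>(x)\<close>. A 2-atom \<open>B\<close> of \<open>\<Gamma>\<^sup>-\<close> with \<open>|B| \<le> |A|\<close> that meets \<open>\<Gamma>(A)\<close> lies in
  \<open>\<Gamma>(A)\<close>, unless \<open>|A| = |B|\<close> and \<open>B\<close> leaves \<open>\<Gamma>(A)\<close> in a single vertex. If \<open>|B| < |A|\<close>, every
  \<open>B\<close> meeting \<open>\<Gamma>(x)\<close> thus lies in \<open>\<Gamma>(x)\<close>, whence \<open>\<Gamma>\<^sup>-(B) = \<Gamma>\<^sup>-(w)\<close> for \<open>w \<in> B\<close>, which is too small.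
  If \<open>|A| = |B|\<close>, take \<open>y \<in> B\<close> and \<open>x \<in> W = \<Gamma>\<^sup>-(B) - \<Gamma>\<^sup>-(y)\<close>, where \<open>|W| = |A| - 1\<close>. A 2-atom \<open>A\<close>
  through \<open>x\<close> either has \<open>y \<in> \<Gamma>(A)\<close> or contains \<open>W\<close>. As \<open>y \<notin> \<Gamma>(x)\<close>, at most one 2-atom through \<open>x\<close>
  is of the first kind, and if \<open>|W| \<ge> 2\<close> at most one is of the second.\<close>

section \<open>Neighbourhoods and submodularity\<close>

locale lf_graph =
  fixes V :: "'a set" and E :: "('a \<times> 'a) set"
  assumes graph: "graph V E"
    and refl: "reflexive_graph V E"
    and locfin: "locally_finite V E"
begin

lemma lf_graph_converse: "lf_graph V (E\<inverse>)"
  using graph refl locfin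
  by unfold_locales (auto simp: graph_def reflexive_graph_def locally_finite_def)

lemma in_nbrs_iff: "y \<in> nbrs E X \<longleftrightarrow> (\<exists>x\<in>X. (x, y) \<in> E)"
  by (auto simp: nbrs_def nbr_def)

lemma nbrs_subset: "nbrs E X \<subseteq> V"
  using graph by (auto simp: graph_def nbrs_def nbr_def)

lemma subset_nbrs: "X \<subseteq> V \<Longrightarrow> X \<subseteq> nbrs E X"
  using refl by (auto simp: reflexive_graph_def nbrs_def nbr_def)

lemma finite_nbrs: "X \<subseteq> V \<Longrightarrow> finite X \<Longrightarrow> finite (nbrs E X)"
  using locfin by (auto simp: locally_finite_def nbrs_def)

lemma nbrs_mono: "X \<subseteq> Y \<Longrightarrow> nbrs E X \<subseteq> nbrs E Y"
  by (auto simp: nbrs_def)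

lemma nbrs_Un: "nbrs E (X \<union> Y) = nbrs E X \<union> nbrs E Y"
  by (auto simp: nbrs_def)

lemma nbrs_singleton: "nbrs E {x} = nbr E x"
  by (simp add: nbrs_def)

lemma nabla_antimono: "X \<subseteq> Y \<Longrightarrow> nabla V E Y \<subseteq> nabla V E X"
  using nbrs_mono by (auto simp: nabla_def)

lemma card_nbrs: "X \<subseteq> V \<Longrightarrow> finite X \<Longrightarrow> card (nbrs E X) = card X + card (bdry E X)"
  using subset_nbrs[of X] finite_nbrs[of X] card_mono[of "nbrs E X" X]
  by (simp add: bdry_def card_Diff_subset)

lemma card_V: "finite V \<Longrightarrow> card V = card (nbrs E X) + card (nabla V E X)"
  using nbrs_subset[of X] finite_subset[OF nbrs_subset, of X] card_mono[of V "nbrs E X"]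
  by (simp add: nabla_def card_Diff_subset)

lemma infinite_nabla: "infinite V \<Longrightarrow> X \<subseteq> V \<Longrightarrow> finite X \<Longrightarrow> infinite (nabla V E X)"
  using finite_nbrs by (simp add: nabla_def Diff_infinite_finite)

text \<open>Neighbourhoods commute with unions, whereas \<Gamma>(X \<inter> Y) is only contained in
  \<Gamma>(X) \<inter> \<Gamma>(Y); this containment is the source of the inequality.\<close>

lemma submodular:
  assumes "X \<subseteq> V" "Y \<subseteq> V" "finite X" "finite Y"
  shows "card (nbrs E (X \<union> Y)) + card (nbrs E (X \<inter> Y)) \<le> card (nbrs E X) + card (nbrs E Y)"
proof -
  have "card (nbrs E X) + card (nbrs E Y) =
      card (nbrs E X \<union> nbrs E Y) + card (nbrs E X \<inter> nbrs E Y)"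
    by (intro card_Un_Int finite_nbrs assms)
  moreover have "card (nbrs E (X \<inter> Y)) \<le> card (nbrs E X \<inter> nbrs E Y)"
    using assms by (intro card_mono) (auto simp: finite_nbrs in_nbrs_iff)
  ultimately show ?thesis by (simp add: nbrs_Un)
qed

section \<open>Fragments, atoms and faithfulness\<close>

lemma card_ge_mono: "card_ge S k \<Longrightarrow> S \<subseteq> T \<Longrightarrow> card_ge T k"
  unfolding card_ge_def by (meson card_mono finite_subset order_trans)

lemma card_ge_1: "card_ge S 1 \<longleftrightarrow> S \<noteq> {}"
  unfolding card_ge_def by (metis card_0_eq finite.emptyI less_one not_le)

text \<open>Minimality of \<kappa>, phrased with |\<Gamma>(X)| instead of the boundary so that it
  combines directly with \<open>submodular\<close>.\<close>

lemma sep_cand_nbrs: "sep_cand V E k X \<Longrightarrow> card X + kappa V E k \<le> card (nbrs E X)"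
  unfolding kappa_def sep_cand_def
  by (subst card_nbrs) (auto simp: sep_cand_def intro!: Least_le)

lemma fragment_exists:
  assumes "separable V E k" shows "\<exists>X. fragment V E k X"
proof -
  obtain X where "sep_cand V E k X" using assms unfolding separable_def by blast
  then have "\<exists>n X. sep_cand V E k X \<and> card (bdry E X) = n" by blast
  from LeastI_ex[OF this] show ?thesis unfolding fragment_def kappa_def by blast
qed

lemma atom_exists:
  assumes "separable V E k" shows "\<exists>A. atom V E k A"
proof -
  obtain X where "fragment V E k X" using fragment_exists[OF assms] by blast
  from ex_has_least_nat[of "fragment V E k", OF this, of card]
  show ?thesis unfolding atom_def by blast
qed

lemma fragment_sep_cand: "fragment V E k X \<Longrightarrow> sep_cand V E k X"
  by (simp add: fragment_def)

lemma fragment_basic: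
  assumes "fragment V E k X"
  shows "X \<subseteq> V" "finite X" "k \<le> card X" "card_ge (nabla V E X) k"
    "card (nbrs E X) = card X + kappa V E k"
  using assms by (auto simp: fragment_def sep_cand_def card_nbrs)

lemma atom_fragment: "atom V E k A \<Longrightarrow> fragment V E k A"
  by (simp add: atom_def)

lemma atom_card_eq: "atom V E k A \<Longrightarrow> atom V E k B \<Longrightarrow> card A = card B"
  by (simp add: atom_def order_antisym)

lemma sep_cand_subset:
  "sep_cand V E k Y \<Longrightarrow> X \<subseteq> Y \<Longrightarrow> k \<le> card X \<Longrightarrow> sep_cand V E k X"
  unfolding sep_cand_def by (meson card_ge_mono finite_subset nabla_antimono order_trans)

text \<open>Since \<nabla> reverses inclusion, X is still a candidate for \<kappa>; being smaller
  than an atom, it cannot attain the minimum.\<close>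

lemma atom_psubset_nbrs:
  assumes A: "atom V E k A" and "X \<subset> A" "k \<le> card X"
  shows "card X + kappa V E k < card (nbrs E X)"
proof -
  note fA = fragment_basic[OF atom_fragment[OF A]]
  have sc: "sep_cand V E k X"
    using sep_cand_subset[OF fragment_sep_cand[OF atom_fragment[OF A]]] assms by blast
  have "card X < card A" using assms fA by (simp add: psubset_card_mono)
  then have "\<not> fragment V E k X" using A by (auto simp: atom_def)
  then have "card (bdry E X) \<noteq> kappa V E k" using sc by (simp add: fragment_def)
  moreover have "card (nbrs E X) = card X + card (bdry E X)"
    using sc by (intro card_nbrs) (auto simp: sep_cand_def)
  ultimately show ?thesis using sep_cand_nbrs[OF sc] by simp
qed

text \<open>\<open>faithful\<close> speaks of some atom. For finite V the size of \<nabla>(A)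
  depends only on |A|, so the inequality passes to every atom; for infinite V, \<nabla>(A) is
  infinite.\<close>

lemma faithful_atom:
  assumes "faithful V E k" "atom V E k A"
  shows "card_ge (nabla V E A) (card A)"
proof (cases "finite V")
  case True
  obtain B where B: "atom V E k B" "card_ge (nabla V E B) (card B)"
    using assms by (auto simp: faithful_def)
  have "card B = card A" using atom_card_eq B assms by blast
  then have "card (nbrs E B) = card (nbrs E A)"
    using B assms fragment_basic(5) atom_fragment by metis
  then have "card (nabla V E B) = card (nabla V E A)"
    using card_V[OF True, of A] card_V[OF True, of B] by simp
  then show ?thesis using B True \<open>card B = card A\<close> by (simp add: card_ge_def nabla_def)
next
  case False
  then show ?thesis
    using infinite_nabla fragment_basic(1,2) atom_fragment assms(2) by (metis card_ge_def)
qed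

lemma faithful_card_V:
  assumes "faithful V E k" "atom V E k A" "finite V"
  shows "2 * card A + kappa V E k \<le> card V"
  using faithful_atom[OF assms(1,2)] card_V[OF assms(3), of A] assms(3)
    fragment_basic(5)[OF atom_fragment[OF assms(2)]]
  by (simp add: card_ge_def nabla_def)

lemma faithful_if_infinite:
  assumes "infinite V" "separable V E k" shows "faithful V E k"
proof -
  obtain A where A: "atom V E k A" using atom_exists[OF assms(2)] by blast
  have "infinite (nabla V E A)"
    using infinite_nabla[OF assms(1) fragment_basic(1,2)[OF atom_fragment[OF A]]] .
  then show ?thesis using A by (auto simp: faithful_def card_ge_def)
qed

text \<open>Otherwise A \<inter> B has a boundary larger than \<kappa>, so by submodularity A
  \<union> B has one smaller than \<kappa>. Faithfulness, as 2|A| + \<kappa> \<le> |V| in the finite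
  case, keeps A \<union> B a candidate, which contradicts the minimality of \<kappa>.\<close>

lemma atom_intersection:
  assumes f: "faithful V E k" and A: "atom V E k A" and B: "atom V E k B"
    and "k \<le> card (A \<inter> B)"
  shows "A = B"
proof (rule ccontr)
  assume "A \<noteq> B"
  note fA = fragment_basic[OF atom_fragment[OF A]] and fB = fragment_basic[OF atom_fragment[OF B]]
  have eq: "card A = card B" using atom_card_eq A B by blast
  have "A \<inter> B \<subset> A"
    using \<open>A \<noteq> B\<close> eq fA fB card_subset_eq[of B A] by auto
  then have lt: "card (A \<inter> B) + kappa V E k < card (nbrs E (A \<inter> B))"
    using atom_psubset_nbrs[OF A] assms by blast
  have un: "card (A \<union> B) + card (A \<inter> B) = 2 * card A"
    using card_Un_Int[OF fA(2) fB(2)] eq by simp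
  have lt': "card (nbrs E (A \<union> B)) < card (A \<union> B) + kappa V E k"
    using submodular[of A B] fA fB lt un eq by simp
  have "card_ge (nabla V E (A \<union> B)) k"
  proof (cases "finite V")
    case True
    have "card (nbrs E (A \<union> B)) + k \<le> card V"
      using lt' un assms(4) faithful_card_V[OF f A True] by simp
    then show ?thesis using card_V[OF True, of "A \<union> B"] by (simp add: card_ge_def)
  next
    case False
    then show ?thesis using infinite_nabla fA fB by (simp add: card_ge_def)
  qed
  moreover have "k \<le> card (A \<union> B)" using fA fB card_mono[of "A \<union> B" A] by simp
  ultimately have "sep_cand V E k (A \<union> B)" using fA fB by (simp add: sep_cand_def)
  from sep_cand_nbrs[OF this] lt' show False by simp
qed

section \<open>Duality between a graph and its reverse\<close>

lemma nabla_converse: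
  assumes "X \<subseteq> V"
  shows "X \<subseteq> nabla V (E\<inverse>) (nabla V E X)" "bdry (E\<inverse>) (nabla V E X) \<subseteq> bdry E X"
  using assms graph unfolding nabla_def bdry_def nbrs_def nbr_def graph_def by auto

lemma nabla_sep_cand:
  assumes "finite V" "sep_cand V E k X" shows "sep_cand V (E\<inverse>) k (nabla V E X)"
  using assms nabla_converse[of X]
  unfolding sep_cand_def card_ge_def
  by (auto simp: nabla_def intro: order_trans[OF _ card_mono])

lemma bdry_finite: "X \<subseteq> V \<Longrightarrow> finite X \<Longrightarrow> finite (bdry E X)"
  by (simp add: bdry_def finite_nbrs)

lemma kappa_converse_le:
  assumes "finite V" "separable V E k" shows "kappa V (E\<inverse>) k \<le> kappa V E k"
proof -
  obtain X where X: "fragment V E k X" using fragment_exists[OF assms(2)] by blast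
  note fX = fragment_basic[OF X]
  interpret rev: lf_graph V "E\<inverse>" by (rule lf_graph_converse)
  have sc: "sep_cand V (E\<inverse>) k (nabla V E X)"
    using nabla_sep_cand[OF assms(1) fragment_sep_cand[OF X]] .
  then have "card (nabla V E X) + kappa V (E\<inverse>) k \<le> card (nbrs (E\<inverse>) (nabla V E X))"
    by (rule rev.sep_cand_nbrs)
  also have "\<dots> = card (nabla V E X) + card (bdry (E\<inverse>) (nabla V E X))"
    using sc by (intro rev.card_nbrs) (auto simp: sep_cand_def)
  also have "card (bdry (E\<inverse>) (nabla V E X)) \<le> card (bdry E X)"
    using fX nabla_converse bdry_finite by (intro card_mono) auto
  finally show ?thesis using X by (simp add: fragment_def)
qed

lemma separable_converse:
  "finite V \<Longrightarrow> separable V E k \<Longrightarrow> separable V (E\<inverse>) k"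
  unfolding separable_def using nabla_sep_cand by blast

lemma kappa_converse:
  assumes "finite V" "separable V E k" shows "kappa V (E\<inverse>) k = kappa V E k"
proof -
  interpret rev: lf_graph V "E\<inverse>" by (rule lf_graph_converse)
  show ?thesis
    using kappa_converse_le[OF assms] rev.kappa_converse_le[OF assms(1) separable_converse[OF assms]]
    by simp
qed

text \<open>The reverse boundary of \<nabla>(X) lies in the boundary of X, and the two values of
  \<kappa> agree, so its size is exactly \<kappa>. Counting V from X and from \<nabla>(X) then shows
  that the double \<nabla>, which contains X, has no more elements than X.\<close>

lemma nabla_fragment:
  assumes "finite V" "fragment V E k X"
  shows "fragment V (E\<inverse>) k (nabla V E X)" "nabla V (E\<inverse>) (nabla V E X) = X"
proof -
  interpret rev: lf_graph V "E\<inverse>" by (rule lf_graph_converse)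
  note fX = fragment_basic[OF assms(2)]
  have sc: "sep_cand V (E\<inverse>) k (nabla V E X)"
    using nabla_sep_cand[OF assms(1) fragment_sep_cand[OF assms(2)]] .
  have "separable V E k" using fragment_sep_cand[OF assms(2)] by (auto simp: separable_def)
  then have k: "kappa V (E\<inverse>) k = kappa V E k" using kappa_converse assms(1) by blast
  have n: "card (nbrs (E\<inverse>) (nabla V E X)) = card (nabla V E X) + card (bdry (E\<inverse>) (nabla V E X))"
    using sc by (intro rev.card_nbrs) (auto simp: sep_cand_def)
  have "card (bdry (E\<inverse>) (nabla V E X)) \<le> card (bdry E X)"
    using fX nabla_converse bdry_finite by (intro card_mono) auto
  moreover have "card (bdry E X) = kappa V E k" using assms(2) by (simp add: fragment_def)
  ultimately have b: "card (bdry (E\<inverse>) (nabla V E X)) = kappa V E k"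
    using rev.sep_cand_nbrs[OF sc] k n by simp
  then show "fragment V (E\<inverse>) k (nabla V E X)" using sc k by (simp add: fragment_def)
  have "card (nabla V (E\<inverse>) (nabla V E X)) = card X"
    using card_V[OF assms(1), of X] rev.card_V[OF assms(1), of "nabla V E X"] n b fX by simp
  then show "nabla V (E\<inverse>) (nabla V E X) = X"
    using nabla_converse(1)[OF fX(1)] assms(1) card_subset_eq[of "nabla V (E\<inverse>) (nabla V E X)" X]
    by (simp add: nabla_def)
qed

text \<open>For atoms A of the graph and B of its reverse, duality gives |B| \<le> |\<nabla>(A)| <
  |A| \<le> |\<nabla>(B)|, the last \<nabla> taken in the reverse.\<close>

lemma faithful_converse:
  assumes "separable V E k" "\<not> faithful V E k"
  shows "finite V" "faithful V (E\<inverse>) k"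
proof -
  show fin: "finite V" using faithful_if_infinite assms by blast
  interpret rev: lf_graph V "E\<inverse>" by (rule lf_graph_converse)
  obtain A where A: "atom V E k A" using atom_exists[OF assms(1)] by blast
  obtain B where B: "atom V (E\<inverse>) k B"
    using rev.atom_exists[OF separable_converse[OF fin assms(1)]] by blast
  have "card (nabla V E A) < card A"
    using assms(2) A by (auto simp: faithful_def card_ge_def)
  moreover have "card B \<le> card (nabla V E A)"
    using B nabla_fragment(1)[OF fin atom_fragment[OF A]] by (simp add: atom_def)
  moreover have "card A \<le> card (nabla V (E\<inverse>) B)"
    using A rev.nabla_fragment(1)[OF fin rev.atom_fragment[OF B]] by (simp add: atom_def)
  ultimately show "faithful V (E\<inverse>) k"
    unfolding faithful_def card_ge_def using B by (meson le_trans less_imp_le_nat)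
qed

section \<open>Automorphisms and blocks; 1-atoms\<close>

lemma automorphism_edge:
  assumes "automorphism V E f" "x \<in> V" "y \<in> V"
  shows "(f x, f y) \<in> E \<longleftrightarrow> (x, y) \<in> E"
proof -
  have inj: "inj_on f V" and e: "nbr E (f x) = f ` nbr E x"
    using assms by (auto simp: automorphism_def bij_betw_def)
  have "nbr E x \<subseteq> V" using graph by (auto simp: graph_def nbr_def)
  then have "f y \<in> f ` nbr E x \<longleftrightarrow> y \<in> nbr E x"
    using inj assms by (simp add: inj_on_image_mem_iff)
  then show ?thesis using e by (auto simp: nbr_def)
qed

lemma automorphism_converse:
  assumes "automorphism V E f" shows "automorphism V (E\<inverse>) f"
proof -
  have bij: "bij_betw f V V" using assms by (simp add: automorphism_def)
  have "nbr (E\<inverse>) (f x) = f ` nbr (E\<inverse>) x" if "x \<in> V" for x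
  proof (intro equalityI subsetI)
    fix y assume y: "y \<in> nbr (E\<inverse>) (f x)"
    then have "y \<in> V" using graph by (auto simp: graph_def nbr_def)
    then obtain z where "z \<in> V" "y = f z" using bij by (auto simp: bij_betw_def)
    then show "y \<in> f ` nbr (E\<inverse>) x"
      using y automorphism_edge[OF assms \<open>z \<in> V\<close> that] by (auto simp: nbr_def)
  next
    fix y assume "y \<in> f ` nbr (E\<inverse>) x"
    then obtain z where z: "(z, x) \<in> E" "y = f z" by (auto simp: nbr_def)
    then have "z \<in> V" using graph by (auto simp: graph_def)
    then show "y \<in> nbr (E\<inverse>) (f x)"
      using z automorphism_edge[OF assms \<open>z \<in> V\<close> that] by (auto simp: nbr_def)
  qed
  then show ?thesis using bij by (simp add: automorphism_def)
qed

lemma automorphism_fragment: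
  assumes f: "automorphism V E f" and X: "fragment V E k X"
  shows "fragment V E k (f ` X)" "card (f ` X) = card X"
proof -
  note fX = fragment_basic[OF X]
  have bij: "inj_on f V" "f ` V = V" and e: "\<And>x. x \<in> V \<Longrightarrow> nbr E (f x) = f ` nbr E x"
    using f by (auto simp: automorphism_def bij_betw_def)
  have n: "nbrs E (f ` X) = f ` nbrs E X"
  proof -
    have "nbrs E (f ` X) = (\<Union>x\<in>X. f ` nbr E x)"
      using e fX(1) unfolding nbrs_def by fastforce
    then show ?thesis by (simp add: nbrs_def image_UN)
  qed
  have c: "card (f ` S) = card S" "finite (f ` S) \<longleftrightarrow> finite S" if "S \<subseteq> V" for S
    using bij that by (auto intro: card_image inj_on_subset dest: finite_imageD)
  show "card (f ` X) = card X" using c fX by simp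
  have nab: "nabla V E (f ` X) = f ` nabla V E X"
    unfolding nabla_def n
    using inj_on_image_set_diff[OF bij(1), of V "nbrs E X"] nbrs_subset[of X] bij(2) by auto
  have "bdry E (f ` X) = f ` bdry E X"
    unfolding bdry_def n
    using inj_on_image_set_diff[OF bij(1), of "nbrs E X" X] nbrs_subset[of X] fX(1) by auto
  moreover have "bdry E X \<subseteq> V" "nabla V E X \<subseteq> V"
    using nbrs_subset by (auto simp: bdry_def nabla_def)
  moreover have "f ` X \<subseteq> V" using fX(1) bij by blast
  ultimately show "fragment V E k (f ` X)"
    using X nab fX c by (simp add: fragment_def sep_cand_def card_ge_def)
qed

lemma automorphism_atom:
  "automorphism V E f \<Longrightarrow> atom V E k A \<Longrightarrow> atom V E k (f ` A)"
  using automorphism_fragment unfolding atom_def by metis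

lemma automorphism_super_fragment:
  "automorphism V E f \<Longrightarrow> super_fragment V E k A \<Longrightarrow> super_fragment V E k (f ` A)"
  using automorphism_fragment unfolding super_fragment_def by metis

lemma is_block_converse: "is_block V (E\<inverse>) B \<Longrightarrow> is_block V E B"
  unfolding is_block_def using automorphism_converse by blast

text \<open>An automorphism sends a 1-atom to a 1-atom, and for k = 1
  \<open>atom_intersection\<close> says that atoms which meet are equal.\<close>

lemma faithful_atom_1_block:
  assumes "faithful V E 1" "atom V E 1 A" shows "is_block V E A"
  unfolding is_block_def
proof (intro conjI allI impI)
  note fA = fragment_basic[OF atom_fragment[OF assms(2)]]
  show "A \<subseteq> V" by (rule fA)
  fix f assume f: "automorphism V E f"
  have "f ` A \<inter> A = {} \<or> 1 \<le> card (f ` A \<inter> A)"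
    using fA(2) by (metis Suc_eq_plus1 add_0 card_gt_0_iff finite_Int less_eq_Suc_le)
  then show "f ` A = A \<or> f ` A \<inter> A = {}"
    using atom_intersection[OF assms(1) automorphism_atom[OF f assms(2)] assms(2)] by blast
qed

lemma atom_1_block:
  assumes "separable V E 1"
  shows "(\<exists>A. atom V E 1 A \<and> is_block V E A) \<or> (\<exists>A. atom V (E\<inverse>) 1 A \<and> is_block V E A)"
proof (cases "faithful V E 1")
  case True
  then show ?thesis using faithful_atom_1_block unfolding faithful_def by blast
next
  case False
  interpret rev: lf_graph V "E\<inverse>" by (rule lf_graph_converse)
  have "faithful V (E\<inverse>) 1" using faithful_converse assms False by blast
  then show ?thesis
    using rev.faithful_atom_1_block is_block_converse unfolding faithful_def by blast
qed

section \<open>Degenerate graphs that are not 2-faithful\<close>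

lemma separable_mono: "separable V E k \<Longrightarrow> j \<le> k \<Longrightarrow> separable V E j"
  unfolding separable_def sep_cand_def card_ge_def by (meson order_trans)

text \<open>The form in which degeneracy is used: the bound by \<open>\<kappa>\<^sub>2\<close>
  extends to sets with X or \<nabla>(X) a singleton.\<close>

lemma degenerate_nbrs:
  assumes "degenerate V E" "X \<subseteq> V" "finite X" "X \<noteq> {}" "nabla V E X \<noteq> {}"
  shows "card X + kappa V E 2 \<le> card (nbrs E X)"
proof -
  have "1 \<le> card X" using assms by (simp add: Suc_leI card_gt_0_iff)
  then have "sep_cand V E 1 X" using assms card_ge_1[of "nabla V E X"] unfolding sep_cand_def by blast
  then show ?thesis using sep_cand_nbrs assms(1) by (metis degenerate_def)
qed

text \<open>If the two sets meet, the degenerate bound applies to A \<union> B, and submodularity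
  leaves at most one vertex in A \<inter> B. Then |V| \<ge> (2|A| - 1) + \<kappa> + 1, whereas
  failure of faithfulness gives |V| = |A| + \<kappa> + |\<nabla>(A)| < 2|A| + \<kappa>.\<close>

lemma nabla_atoms_disjoint:
  assumes deg: "degenerate V E" and nf: "\<not> faithful V E 2"
    and A: "atom V E 2 A" and B: "atom V E 2 B" and "A \<noteq> B"
  shows "nabla V E A \<inter> nabla V E B = {}"
proof (rule ccontr)
  assume ne: "nabla V E A \<inter> nabla V E B \<noteq> {}"
  have fin: "finite V" using faithful_converse(1) deg nf by (auto simp: degenerate_def)
  note fA = fragment_basic[OF atom_fragment[OF A]] and fB = fragment_basic[OF atom_fragment[OF B]]
  have eq: "card A = card B" using atom_card_eq A B by blast
  have n: "nabla V E (A \<union> B) = nabla V E A \<inter> nabla V E B"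
    by (auto simp: nabla_def nbrs_Un)
  have un: "card (A \<union> B) + card (A \<inter> B) = 2 * card A"
    using card_Un_Int[OF fA(2) fB(2)] eq by simp
  have le: "card (A \<union> B) + kappa V E 2 \<le> card (nbrs E (A \<union> B))"
    using degenerate_nbrs[OF deg, of "A \<union> B"] fA fB ne n \<open>A \<noteq> B\<close> by auto
  have "A \<inter> B \<subset> A"
    using \<open>A \<noteq> B\<close> eq fA fB card_subset_eq[of B A] by auto
  have "\<not> 2 \<le> card (A \<inter> B)"
    using atom_psubset_nbrs[OF A \<open>A \<inter> B \<subset> A\<close>] submodular[of A B] fA fB le un eq by auto
  moreover have "card (nabla V E A) < card A"
    using nf A by (auto simp: faithful_def card_ge_def)
  moreover have "1 \<le> card (nabla V E (A \<union> B))"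
    using ne n fin by (simp add: Suc_leI card_gt_0_iff nabla_def)
  ultimately show False
    using card_V[OF fin, of A] card_V[OF fin, of "A \<union> B"] le un fA(5) by simp
qed

text \<open>On fragments |\<nabla>(Y)| = |V| - |Y| - \<kappa>, so the duality turns largest into
  smallest.\<close>

lemma super_fragment_converse_atom:
  assumes "separable V E k" "super_fragment V (E\<inverse>) k X"
  obtains A where "atom V E k A" "X = nabla V E A"
proof -
  interpret rev: lf_graph V "E\<inverse>" by (rule lf_graph_converse)
  have fin: "finite V" and X: "fragment V (E\<inverse>) k X"
    using assms(2) by (auto simp: super_fragment_def)
  note AX = rev.nabla_fragment[OF fin X, unfolded converse_converse]
  let ?A = "nabla V (E\<inverse>) X"
  have "card ?A \<le> card Y" if Y: "fragment V E k Y" for Y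
  proof -
    have "card (nabla V E Y) \<le> card (nabla V E ?A)"
      using assms(2) nabla_fragment[OF fin Y] AX(2) by (simp add: super_fragment_def)
    then show ?thesis
      using card_V[OF fin, of Y] card_V[OF fin, of ?A] fragment_basic(5)[OF Y]
        fragment_basic(5)[OF AX(1)] by simp
  qed
  then have "atom V E k ?A" using AX by (simp add: atom_def)
  then show ?thesis using that AX by metis
qed

lemma super_fragment_exists:
  assumes "finite V" "separable V E k" shows "\<exists>X. super_fragment V E k X"
proof -
  obtain X where "fragment V E k X" using fragment_exists[OF assms(2)] by blast
  moreover have "\<forall>Y. fragment V E k Y \<longrightarrow> card Y < Suc (card V)"
    using assms(1) fragment_basic(1) by (simp add: card_mono le_imp_less_Suc)
  ultimately show ?thesis
    using ex_has_greatest_nat[of "fragment V E k" X card "Suc (card V)"] assms(1)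
    unfolding super_fragment_def by (meson less_imp_le)
qed

lemma super_fragment_block:
  assumes deg: "degenerate V E" and nf: "\<not> faithful V E 2"
  shows "\<exists>X. super_fragment V (E\<inverse>) 2 X \<and> is_block V E X"
proof -
  interpret rev: lf_graph V "E\<inverse>" by (rule lf_graph_converse)
  have sep: "separable V E 2" using deg by (simp add: degenerate_def)
  have fin: "finite V" using faithful_converse(1) sep nf by blast
  obtain X where X: "super_fragment V (E\<inverse>) 2 X"
    using rev.super_fragment_exists[OF fin separable_converse[OF fin sep]] by blast
  have "is_block V E X"
    unfolding is_block_def
  proof (intro conjI allI impI)
    show "X \<subseteq> V" using X unfolding super_fragment_def by (meson rev.fragment_basic(1))
    fix f assume "automorphism V E f"
    then have fX: "super_fragment V (E\<inverse>) 2 (f ` X)"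
      using X automorphism_converse rev.automorphism_super_fragment by blast
    obtain A where "atom V E 2 A" "X = nabla V E A"
      using super_fragment_converse_atom[OF sep X] .
    moreover obtain B where "atom V E 2 B" "f ` X = nabla V E B"
      using super_fragment_converse_atom[OF sep fX] .
    ultimately show "f ` X = X \<or> f ` X \<inter> X = {}"
      using nabla_atoms_disjoint[OF deg nf] by metis
  qed
  then show ?thesis using X by blast
qed

section \<open>Degrees, and the interaction of 2-atoms\<close>

lemma vertex_transitive_card_nbr:
  assumes "vertex_transitive V E" "x \<in> V" "y \<in> V"
  shows "card (nbr E x) = card (nbr E y)"
proof -
  obtain f where f: "automorphism V E f" "f x = y"
    using assms unfolding vertex_transitive_def by blast
  have "nbr E x \<subseteq> V" using graph by (auto simp: graph_def nbr_def)
  then have "card (f ` nbr E x) = card (nbr E x)"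
    using f by (intro card_image) (auto simp: automorphism_def bij_betw_def intro: inj_on_subset)
  then show ?thesis using f assms by (auto simp: automorphism_def)
qed

lemma vertex_transitive_converse:
  "vertex_transitive V E \<Longrightarrow> vertex_transitive V (E\<inverse>)"
  unfolding vertex_transitive_def using automorphism_converse by blast

lemma card_edges:
  assumes "finite V" shows "card E = (\<Sum>x\<in>V. card (nbr E x))"
proof -
  have "E = Sigma V (nbr E)" using graph by (auto simp: graph_def nbr_def)
  moreover have "card (Sigma V (nbr E)) = (\<Sum>x\<in>V. card (nbr E x))"
    using assms locfin by (intro card_SigmaI) (auto simp: locally_finite_def)
  ultimately show ?thesis by simp
qed

text \<open>Both degrees are constant, so counting the edges from either end gives |V| times each of
  them.\<close>

lemma vertex_transitive_degrees:
  assumes "finite V" "vertex_transitive V E" "x \<in> V"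
  shows "card (nbr (E\<inverse>) x) = card (nbr E x)"
proof -
  interpret rev: lf_graph V "E\<inverse>" by (rule lf_graph_converse)
  have "card E = card V * card (nbr E x)"
    using card_edges[OF assms(1)] vertex_transitive_card_nbr[OF assms(2) _ assms(3)] by simp
  moreover have "card (E\<inverse>) = card V * card (nbr (E\<inverse>) x)"
    using rev.card_edges[OF assms(1)]
      rev.vertex_transitive_card_nbr[OF vertex_transitive_converse[OF assms(2)] _ assms(3)] by simp
  moreover have "card V > 0" using assms by (auto simp: card_gt_0_iff)
  ultimately show ?thesis by simp
qed

text \<open>A singleton 1-atom shows the degree at once. If instead \<nabla>(A) is a singleton, it
  is a 1-fragment of the reverse, and in a finite graph the two degrees agree.\<close>

lemma cauchy_degree:
  assumes "vertex_transitive V E" "cauchy V E" "degenerate V E" "x \<in> V"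
  shows "card (nbrs E {x}) = Suc (kappa V E 2)"
proof -
  have sep: "separable V E 1"
    using assms(3) separable_mono[of 2 1] by (simp add: degenerate_def)
  have k: "kappa V E 2 = kappa V E 1" using assms(3) by (simp add: degenerate_def)
  obtain A where A: "atom V E 1 A"
    and or: "card A = 1 \<or> (finite (nabla V E A) \<and> card (nabla V E A) = 1)"
    using assms(2) sep unfolding cauchy_def by blast
  note fA = fragment_basic[OF atom_fragment[OF A]]
  from or show ?thesis
  proof
    assume "card A = 1"
    then obtain y where y: "A = {y}" by (auto simp: card_1_singleton_iff)
    then have "card (nbr E x) = card (nbr E y)"
      using vertex_transitive_card_nbr[OF assms(1)] assms(4) fA(1) by blast
    then show ?thesis using fA(5) y k by (simp add: nbrs_singleton)
  next
    assume n: "finite (nabla V E A) \<and> card (nabla V E A) = 1"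
    interpret rev: lf_graph V "E\<inverse>" by (rule lf_graph_converse)
    obtain y where y: "nabla V E A = {y}" using n by (auto simp: card_1_singleton_iff)
    have fin: "finite V" using n infinite_nabla fA by blast
    have "card (nbr (E\<inverse>) y) = Suc (kappa V E 1)"
      using rev.fragment_basic(5)[OF nabla_fragment(1)[OF fin atom_fragment[OF A]]]
        kappa_converse[OF fin sep] y by (simp add: rev.nbrs_singleton)
    moreover have "y \<in> V" using y by (auto simp: nabla_def)
    ultimately show ?thesis
      using vertex_transitive_degrees[OF fin assms(1), of y]
        vertex_transitive_card_nbr[OF assms(1,4), of y] k by (simp add: nbrs_singleton)
  qed
qed

text \<open>Let Z be the part of B outside \<Gamma>(A) and W the part of A outside
  \<open>\<Gamma>\<^sup>-(B)\<close>. No edge runs from A to Z or from W to B, so the neighbourhoods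
  of Z and W are small. The degenerate bounds force |W| + |B| = |A| + |Z| and make Z and W tight; a
  tight proper subset of a 2-atom has fewer than two vertices.\<close>

lemma crossing_atoms:
  assumes deg: "degenerate V E" and degr: "degenerate V (E\<inverse>)"
    and A: "atom V E 2 A" and B: "atom V (E\<inverse>) 2 B" and ba: "card B \<le> card A"
    and meets: "B \<inter> nbrs E A \<noteq> {}" and exceeds: "\<not> B \<subseteq> nbrs E A"
  shows "card (B - nbrs E A) = 1" "card A = card B"
proof -
  interpret rev: lf_graph V "E\<inverse>" by (rule lf_graph_converse)
  note fA = fragment_basic[OF atom_fragment[OF A]]
    and fB = rev.fragment_basic[OF rev.atom_fragment[OF B]]
  define Z where "Z = B - nbrs E A"
  define W where "W = A - nbrs (E\<inverse>) B"
  have Z: "Z \<subset> B" "Z \<noteq> {}" "Z \<subseteq> V" "finite Z"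
    using meets exceeds fB by (auto simp: Z_def)
  have W: "W \<subseteq> A" "W \<subseteq> V" "finite W" using fA by (auto simp: W_def)
  have "nbrs (E\<inverse>) Z \<subseteq> nbrs (E\<inverse>) B - (A - W)"
    by (auto simp: Z_def rev.in_nbrs_iff in_nbrs_iff)
  then have "card (nbrs (E\<inverse>) Z) \<le> card (nbrs (E\<inverse>) B - (A - W))"
    using fB by (intro card_mono) (auto simp: rev.finite_nbrs)
  also have "\<dots> = card (nbrs (E\<inverse>) B) - (card A - card W)"
    using fA W by (subst card_Diff_subset) (auto simp: W_def card_Diff_subset)
  \<comment> \<open>The second disjunct absorbs truncated subtraction; it is refuted once Z is known
    to be nonempty and \<open>Zge\<close> holds.\<close>
  finally have Zle: "card (nbrs (E\<inverse>) Z) + card A \<le> card B + kappa V (E\<inverse>) 2 + card W \<or>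
      card (nbrs (E\<inverse>) Z) = 0"
    using fB(5) card_mono[OF fA(2) W(1)] by linarith
  have "nbrs E W \<subseteq> nbrs E A - (B - Z)"
    by (auto simp: W_def Z_def rev.in_nbrs_iff in_nbrs_iff)
  then have "card (nbrs E W) \<le> card (nbrs E A - (B - Z))"
    using fA by (intro card_mono) (auto simp: finite_nbrs)
  also have "\<dots> = card (nbrs E A) - (card B - card Z)"
    using fB Z by (subst card_Diff_subset) (auto simp: Z_def card_Diff_subset)
  finally have Wle: "card (nbrs E W) + card B \<le> card A + kappa V E 2 + card Z \<or>
      card (nbrs E W) = 0"
    using fA(5) card_mono[OF fB(2), of Z] Z by fastforce
  have nablas: "nabla V (E\<inverse>) Z \<noteq> {}" "nabla V E W \<noteq> {}"
    using rev.nabla_antimono[of Z B] nabla_antimono[OF W(1)] Z(1) fA(4) fB(4)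
    by (auto simp: card_ge_def)
  have Zge: "card Z + kappa V (E\<inverse>) 2 \<le> card (nbrs (E\<inverse>) Z)"
    using rev.degenerate_nbrs[OF degr Z(3,4,2) nablas(1)] .
  have Zpos: "1 \<le> card Z" "card Z < card B"
    using Z fB(2) by (auto simp: Suc_leI card_gt_0_iff psubset_card_mono)
  \<comment> \<open>Here |B| \<le> |A| enters: |W| \<ge> |Z| + |A| - |B| \<ge> |Z|.\<close>
  have "1 \<le> card W" using Zle Zge Zpos ba by linarith
  then have Wge: "card W + kappa V E 2 \<le> card (nbrs E W)"
    using degenerate_nbrs[OF deg W(2,3) _ nablas(2)] by force
  have eq: "card W + card B = card A + card Z" and
    eqs: "card (nbrs (E\<inverse>) Z) = card Z + kappa V (E\<inverse>) 2" "card (nbrs E W) = card W + kappa V E 2"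
    using Zle Zge Wle Wge Zpos \<open>1 \<le> card W\<close> by linarith+
  show "card (B - nbrs E A) = 1"
    using rev.atom_psubset_nbrs[OF B Z(1)] eqs(1) Zpos by (fold Z_def) linarith
  then have "card Z = 1" by (simp add: Z_def)
  have "card W \<noteq> card A" using eq Zpos by linarith
  then have "W \<subset> A" using W(1) by auto
  then have "card W = 1"
    using atom_psubset_nbrs[OF A] eqs(2) \<open>1 \<le> card W\<close> by (metis Suc_1 le_antisym less_irrefl not_less_eq_eq One_nat_def)
  then show "card A = card B" using eq \<open>card Z = 1\<close> by simp
qed

text \<open>The degenerate bound for A \<union> B leaves |\<Gamma>(A) \<inter> \<Gamma>(B)| \<le>
  2(|A| + \<kappa>) - (2|A| - 1 + \<kappa>) = \<kappa> + 1, which is already the size of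
  \<Gamma>(x).\<close>

lemma nbrs_Int_atoms:
  assumes vt: "vertex_transitive V E" and ca: "cauchy V E" and deg: "degenerate V E"
    and f: "faithful V E 2" and A: "atom V E 2 A" and B: "atom V E 2 B"
    and "A \<noteq> B" "x \<in> A" "x \<in> B"
  shows "A \<inter> B = {x}" "nbrs E A \<inter> nbrs E B = nbrs E {x}"
proof -
  note fA = fragment_basic[OF atom_fragment[OF A]] and fB = fragment_basic[OF atom_fragment[OF B]]
  have eq: "card A = card B" using atom_card_eq A B by blast
  have "\<not> 2 \<le> card (A \<inter> B)" using atom_intersection[OF f A B] assms by blast
  moreover have "card (A \<inter> B) \<noteq> 0" using fA assms by auto
  ultimately have c1: "card (A \<inter> B) = 1" by linarith
  then show AB: "A \<inter> B = {x}" using assms by (metis IntI card_1_singletonE singletonD)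
  have un: "card (A \<union> B) + 1 = 2 * card A"
    using card_Un_Int[OF fA(2) fB(2)] eq c1 by simp
  have dx: "card (nbrs E {x}) = Suc (kappa V E 2)"
    using cauchy_degree[OF vt ca deg] assms fA by blast
  have sub: "card (nbrs E (A \<union> B)) + Suc (kappa V E 2) \<le> 2 * (card A + kappa V E 2)"
    using submodular[of A B] fA fB dx AB eq by simp
  have "nabla V E (A \<union> B) \<noteq> {}"
  proof (cases "finite V")
    case True
    then show ?thesis
      using card_V[OF True, of "A \<union> B"] sub faithful_card_V[OF f A True] by auto
  next
    case False
    then show ?thesis using infinite_nabla[of "A \<union> B"] fA fB by fastforce
  qed
  then have "card (A \<union> B) + kappa V E 2 \<le> card (nbrs E (A \<union> B))"
    using degenerate_nbrs[OF deg, of "A \<union> B"] fA fB assms by auto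
  moreover have "card (nbrs E A) + card (nbrs E B) =
      card (nbrs E A \<union> nbrs E B) + card (nbrs E A \<inter> nbrs E B)"
    using fA fB by (intro card_Un_Int finite_nbrs)
  ultimately have "card (nbrs E A \<inter> nbrs E B) \<le> card (nbrs E {x})"
    using un fA fB eq dx by (simp add: nbrs_Un)
  moreover have "nbrs E {x} \<subseteq> nbrs E A \<inter> nbrs E B"
    using assms nbrs_mono[of "{x}"] by auto
  ultimately show "nbrs E A \<inter> nbrs E B = nbrs E {x}"
    using card_seteq[of "nbrs E A \<inter> nbrs E B"] finite_nbrs fA by (metis finite_Int)
qed

lemma no_two_larger_atoms:
  assumes vt: "vertex_transitive V E" and ca: "cauchy V E" "cauchy V (E\<inverse>)"
    and deg: "degenerate V E" "degenerate V (E\<inverse>)" and f: "faithful V E 2"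
    and two: "\<And>x. x \<in> V \<Longrightarrow> \<exists>A A'. atom V E 2 A \<and> atom V E 2 A' \<and> A \<noteq> A' \<and> x \<in> A \<and> x \<in> A'"
    and B: "atom V (E\<inverse>) 2 B"
  shows "\<exists>A. atom V E 2 A \<and> card A \<le> card B"
proof (rule ccontr)
  assume neg: "\<not> ?thesis"
  interpret rev: lf_graph V "E\<inverse>" by (rule lf_graph_converse)
  note fB = rev.fragment_basic[OF rev.atom_fragment[OF B]]
  \<comment> \<open>B cannot cross a strictly larger atom, so it lies in \<Gamma>(C) for both atoms
    C through u, hence in their intersection \<Gamma>(u).\<close>
  have closed: "B \<subseteq> nbrs E {u}" if u: "u \<in> V" and "B \<inter> nbrs E {u} \<noteq> {}" for u
  proof -
    obtain A A' where AA: "atom V E 2 A" "atom V E 2 A'" "A \<noteq> A'" "u \<in> A" "u \<in> A'"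
      using two[OF u] by blast
    have "B \<subseteq> nbrs E C" if C: "atom V E 2 C" "u \<in> C" for C
    proof (rule ccontr)
      assume "\<not> B \<subseteq> nbrs E C"
      moreover have "B \<inter> nbrs E C \<noteq> {}"
        using \<open>B \<inter> nbrs E {u} \<noteq> {}\<close> nbrs_mono[of "{u}" C] C by auto
      moreover have "card B < card C" using neg C by force
      ultimately show False using crossing_atoms(2)[OF deg C(1) B] by simp
    qed
    then show ?thesis using nbrs_Int_atoms(2)[OF vt ca(1) deg(1) f AA] AA by blast
  qed
  obtain w where w: "w \<in> B" using fB(3) by (cases "B = {}") auto
  have "nbrs (E\<inverse>) B \<subseteq> nbrs (E\<inverse>) {w}"
  proof
    fix u assume "u \<in> nbrs (E\<inverse>) B"
    then have "u \<in> V" "B \<inter> nbrs E {u} \<noteq> {}"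
      using graph by (auto simp: graph_def rev.in_nbrs_iff in_nbrs_iff)
    then show "u \<in> nbrs (E\<inverse>) {w}"
      using closed[of u] w by (auto simp: rev.in_nbrs_iff in_nbrs_iff)
  qed
  \<comment> \<open>The left side is |B| + \<kappa> \<ge> \<kappa> + 2, the right side \<kappa> +
    1.\<close>
  then have "card (nbrs (E\<inverse>) B) \<le> card (nbrs (E\<inverse>) {w})"
    using w fB by (intro card_mono rev.finite_nbrs) auto
  then show False
    using rev.cauchy_degree[OF vertex_transitive_converse[OF vt] ca(2) deg(2)] w fB by force
qed

lemma no_three_equal_atoms:
  assumes vt: "vertex_transitive V E" and ca: "cauchy V E" "cauchy V (E\<inverse>)"
    and deg: "degenerate V E" "degenerate V (E\<inverse>)" and f: "faithful V E 2"
    and three: "\<And>x. x \<in> V \<Longrightarrow> \<exists>A1 A2 A3. atom V E 2 A1 \<and> atom V E 2 A2 \<and> atom V E 2 A3 \<and>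
        A1 \<noteq> A2 \<and> A1 \<noteq> A3 \<and> A2 \<noteq> A3 \<and> x \<in> A1 \<and> x \<in> A2 \<and> x \<in> A3"
    and A: "atom V E 2 A" and B: "atom V (E\<inverse>) 2 B" and eq: "card A = card B"
  shows "card A = 2"
proof (rule ccontr)
  assume "card A \<noteq> 2"
  interpret rev: lf_graph V "E\<inverse>" by (rule lf_graph_converse)
  note fB = rev.fragment_basic[OF rev.atom_fragment[OF B]]
  have a3: "3 \<le> card A"
    using \<open>card A \<noteq> 2\<close> fragment_basic(3)[OF atom_fragment[OF A]] by linarith
  obtain y where y: "y \<in> B" "y \<in> V" using fB(1,3) by (cases "B = {}") auto
  define W where "W = nbrs (E\<inverse>) B - nbrs (E\<inverse>) {y}"
  have finW: "finite W" using fB by (simp add: W_def rev.finite_nbrs)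
  have "nbrs (E\<inverse>) {y} \<subseteq> nbrs (E\<inverse>) B" using rev.nbrs_mono y by simp
  moreover have "card (nbrs (E\<inverse>) {y}) = Suc (kappa V (E\<inverse>) 2)"
    using rev.cauchy_degree[OF vertex_transitive_converse[OF vt] ca(2) deg(2) y(2)] .
  \<comment> \<open>|W| = (|B| + \<kappa>) - (\<kappa> + 1), so W has at least two elements.\<close>
  ultimately have cW: "card W + 1 = card A"
    using fB(5) eq a3 y rev.finite_nbrs[of "{y}"] by (simp add: W_def card_Diff_subset)
  then obtain x where x: "x \<in> W" using a3 by (cases "W = {}") auto
  then have xV: "x \<in> V" and xB: "x \<in> nbrs (E\<inverse>) B" and xy: "y \<notin> nbrs E {x}"
    using graph by (auto simp: graph_def W_def rev.in_nbrs_iff in_nbrs_iff)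
  \<comment> \<open>By \<open>crossing_atoms\<close> in the reverse graph, C has at most one vertex
    outside \<open>\<Gamma>\<^sup>-(B)\<close>. The others avoid \<open>\<Gamma>\<^sup>-(y)\<close>,
    so at least |C| - 1 = |W| vertices of C lie in W and fill it.\<close>
  have W_sub: "W \<subseteq> C" if C: "atom V E 2 C" "x \<in> C" "y \<notin> nbrs E C" for C
  proof -
    note fC = fragment_basic[OF atom_fragment[OF C(1)]]
    have cC: "card C = card A" using atom_card_eq C A by blast
    have "card (C - nbrs (E\<inverse>) B) \<le> 1"
    proof (cases "C \<subseteq> nbrs (E\<inverse>) B")
      case True
      then show ?thesis by (simp add: Diff_eq_empty_iff[THEN iffD2])
    next
      case False
      moreover have "C \<inter> nbrs (E\<inverse>) B \<noteq> {}" using C xB by blast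
      ultimately show ?thesis
        using rev.crossing_atoms(1)[OF deg(2) _ B, of C] deg(1) C(1) cC eq by simp
    qed
    moreover have "card C = card (C \<inter> nbrs (E\<inverse>) B) + card (C - nbrs (E\<inverse>) B)"
      using card_Int_Diff[OF fC(2)] .
    ultimately have "card W \<le> card (C \<inter> nbrs (E\<inverse>) B)" using cW cC by linarith
    moreover have "C \<inter> nbrs (E\<inverse>) B \<subseteq> W"
      using C(3) by (auto simp: W_def rev.in_nbrs_iff in_nbrs_iff)
    ultimately have "C \<inter> nbrs (E\<inverse>) B = W" using card_seteq finW by metis
    then show ?thesis by blast
  qed
  have W_big: "\<not> W \<subseteq> {x}" using cW a3 card_mono[of "{x}" W] by auto
  \<comment> \<open>If y lay in both neighbourhoods it would lie in \<Gamma>(x); if in neither, W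
    would be contained in C \<inter> D = {x}. Three distinct atoms cannot pairwise disagree on a
    two-valued property.\<close>
  have pair: "y \<in> nbrs E C \<longleftrightarrow> y \<notin> nbrs E D"
    if CD: "atom V E 2 C" "atom V E 2 D" "C \<noteq> D" "x \<in> C" "x \<in> D" for C D
    using nbrs_Int_atoms[OF vt ca(1) deg(1) f CD] W_sub[of C] W_sub[of D] CD xy W_big by blast
  show False using three[OF xV] pair by metis
qed

text \<open>Transports the configuration from one vertex to all, as needed when the two lemmas above
  choose their own vertices. Injectivity keeps the images distinct.\<close>

lemma three_atoms_everywhere:
  assumes vt: "vertex_transitive V E" and "x \<in> V" "y \<in> V"
    and "\<exists>A B C. atom V E k A \<and> atom V E k B \<and> atom V E k C \<and>
        A \<noteq> B \<and> A \<noteq> C \<and> B \<noteq> C \<and> x \<in> A \<and> x \<in> B \<and> x \<in> C"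
  shows "\<exists>A B C. atom V E k A \<and> atom V E k B \<and> atom V E k C \<and>
        A \<noteq> B \<and> A \<noteq> C \<and> B \<noteq> C \<and> y \<in> A \<and> y \<in> B \<and> y \<in> C"
proof -
  obtain A B C where *: "atom V E k A" "atom V E k B" "atom V E k C"
    "A \<noteq> B" "A \<noteq> C" "B \<noteq> C" "x \<in> A" "x \<in> B" "x \<in> C"
    using assms(4) by blast
  obtain f where f: "automorphism V E f" "f x = y"
    using assms unfolding vertex_transitive_def by blast
  have inj: "inj_on f V" using f by (simp add: automorphism_def bij_betw_def)
  have sub: "A \<subseteq> V" "B \<subseteq> V" "C \<subseteq> V" using * fragment_basic(1) atom_fragment by blast+
  have "f ` A \<noteq> f ` B" "f ` A \<noteq> f ` C" "f ` B \<noteq> f ` C"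
    using * sub inj by (simp_all add: inj_on_image_eq_iff)
  moreover have "y \<in> f ` A" "y \<in> f ` B" "y \<in> f ` C" using * f by auto
  moreover have "atom V E k (f ` A)" "atom V E k (f ` B)" "atom V E k (f ` C)"
    using automorphism_atom[OF f(1)] * by simp_all
  ultimately show ?thesis
    by (intro exI[of _ "f ` A"] exI[of _ "f ` B"] exI[of _ "f ` C"] conjI)
qed

text \<open>\<open>no_two_larger_atoms\<close>, applied to the graph and to its reverse, makes the
  two atom sizes equal, which is the situation of \<open>no_three_equal_atoms\<close>.\<close>

lemma three_atoms_both:
  assumes vt: "vertex_transitive V E" and ca: "cauchy V E" "cauchy V (E\<inverse>)"
    and deg: "degenerate V E" "degenerate V (E\<inverse>)"
    and f: "faithful V E 2" "faithful V (E\<inverse>) 2" and "x \<in> V"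
    and three: "\<exists>A B C. atom V E 2 A \<and> atom V E 2 B \<and> atom V E 2 C \<and>
        A \<noteq> B \<and> A \<noteq> C \<and> B \<noteq> C \<and> x \<in> A \<and> x \<in> B \<and> x \<in> C"
    and three': "\<exists>A B C. atom V (E\<inverse>) 2 A \<and> atom V (E\<inverse>) 2 B \<and> atom V (E\<inverse>) 2 C \<and>
        A \<noteq> B \<and> A \<noteq> C \<and> B \<noteq> C \<and> x \<in> A \<and> x \<in> B \<and> x \<in> C"
    and A: "atom V E 2 A"
  shows "card A = 2"
proof -
  interpret rev: lf_graph V "E\<inverse>" by (rule lf_graph_converse)
  note vt' = vertex_transitive_converse[OF vt]
  note all = three_atoms_everywhere[OF vt \<open>x \<in> V\<close> _ three]
  note all' = rev.three_atoms_everywhere[OF vt' \<open>x \<in> V\<close> _ three']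
  obtain B where B: "atom V (E\<inverse>) 2 B" using three' by blast
  have "\<exists>A A'. atom V E 2 A \<and> atom V E 2 A' \<and> A \<noteq> A' \<and> z \<in> A \<and> z \<in> A'" if "z \<in> V" for z
    using all[OF that] by blast
  then have "\<exists>C. atom V E 2 C \<and> card C \<le> card B"
    using no_two_larger_atoms[OF vt ca deg f(1) _ B] by blast
  then have le: "card A \<le> card B" using atom_card_eq A by metis
  have "\<exists>A A'. atom V (E\<inverse>) 2 A \<and> atom V (E\<inverse>) 2 A' \<and> A \<noteq> A' \<and> z \<in> A \<and> z \<in> A'" if "z \<in> V" for z
    using all'[OF that] by blast
  then have "\<exists>C. atom V (E\<inverse>) 2 C \<and> card C \<le> card A"
    using rev.no_two_larger_atoms[OF vt' ca(2) _ deg(2) _ f(2), of A] ca(1) deg(1) A by simp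
  then have "card B \<le> card A" using rev.atom_card_eq B by metis
  then show ?thesis
    using no_three_equal_atoms[OF vt ca deg f(1) all A B] le by simp
qed

end

section \<open>Assembling the four alternatives\<close>

theorem theorem7p2:
  fixes V :: "'a set" and E :: "('a \<times> 'a) set"
  assumes "graph V E"
    and "reflexive_graph V E"
    and "locally_finite V E"
    and "vertex_transitive V E"
    and "degenerate V E"
    and "degenerate V (converse E)"
  shows "((\<not> cauchy V E \<or> \<not> cauchy V (converse E)) \<and>
           ((\<exists>A. atom V E 1 A \<and> is_block V E A) \<or>
            (\<exists>A. atom V (converse E) 1 A \<and> is_block V E A)))
       \<or> ((\<not> faithful V E 2 \<and>
             (\<exists>X. super_fragment V (converse E) 2 X \<and> is_block V E X)) \<or>
           (\<not> faithful V (converse E) 2 \<and>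
             (\<exists>X. super_fragment V E 2 X \<and> is_block V E X)))
       \<or> (faithful V E 2 \<and> faithful V (converse E) 2 \<and>
           cauchy V E \<and> cauchy V (converse E) \<and>
           \<not> (\<exists>x\<in>V.
                 (\<exists>A B C. atom V E 2 A \<and> atom V E 2 B \<and> atom V E 2 C \<and>
                    A \<noteq> B \<and> A \<noteq> C \<and> B \<noteq> C \<and> x \<in> A \<and> x \<in> B \<and> x \<in> C) \<and>
                 (\<exists>A B C. atom V (converse E) 2 A \<and> atom V (converse E) 2 B \<and>
                    atom V (converse E) 2 C \<and>
                    A \<noteq> B \<and> A \<noteq> C \<and> B \<noteq> C \<and> x \<in> A \<and> x \<in> B \<and> x \<in> C)))
       \<or> ((\<forall>A. atom V E 2 A \<longrightarrow> card A = 2) \<or>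
          (\<forall>A. atom V (converse E) 2 A \<longrightarrow> card A = 2))"
proof -
  interpret lf_graph V E using assms by unfold_locales
  interpret rev: lf_graph V "E\<inverse>" by (rule lf_graph_converse)
  have sep: "separable V E 1"
    using assms(5) separable_mono[of 2 1] by (simp add: degenerate_def)
  consider "\<not> cauchy V E \<or> \<not> cauchy V (E\<inverse>)" | "\<not> faithful V E 2" | "\<not> faithful V (E\<inverse>) 2"
    | "cauchy V E" "cauchy V (E\<inverse>)" "faithful V E 2" "faithful V (E\<inverse>) 2" by blast
  then show ?thesis
  proof cases
    case 1
    then show ?thesis using atom_1_block[OF sep] by argo
  next
    case 2
    then show ?thesis using super_fragment_block[OF assms(5)] by blast
  next
    case 3
    then have "\<exists>X. super_fragment V E 2 X \<and> is_block V E X"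
      using rev.super_fragment_block[OF assms(6)] is_block_converse by auto
    then show ?thesis using 3 by blast
  next
    case 4
    \<comment> \<open>A vertex violating (iii) forces every 2-atom of \<Gamma> to have two elements,
      which is (iv).\<close>
    show ?thesis
      using 4 three_atoms_both[OF assms(4) 4(1,2) assms(5,6) 4(3,4)] by metis
  qed
qed

end
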